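(* Let $X$ be a set and let $k:X\times X\to\mathbb{C}$ be a positive semi-definite kernel such that $k(x,y)\neq 0$ for all $x,y\in X$. If $k$ has the complete Pick property, then for each $z\in X$ the kernel $$F_z(x,y) := 1-\frac{k(x,z)\,k(z,y)}{k(z,z)\,k(x,y)},\qquad x,y\in X,$$ is positive semi-definite on $X$.
   Context: A function $k:X\times X\to\mathbb{C}$ is a positive semi-definite (PSD) kernel if for every finite list $x_1,\dots,x_n\in X$ the matrix $(k(x_i,x_j))_{i,j}$ is (Hermitian) positive semi-definite. Its associated reproducing kernel Hilbert space of functions on $X$ is denoted $H$, with kernel functions $k_y(x)=k(x,y)$ satisfying $f(y)=\langle f,k_y\rangle$ for $f\in H$. For a Hilbert space $L$, the elements of $H\otimes L$ are regarded as $L$-valued functions on $X$, via $\langle f(y),v\rangle_L=\langle f,k_y\otimes v\rangle$ for $v \in L$, $y\in X$. For Hilbert spaces $L_1,L_2$, let $B(L_1,L_2)$ denote the bounded linear operators from $L_1$ to $L_2$. A function $\Phi:X\to B(L_1,L_2)$ belongs to $\mathrm{Mult}_1(H\otimes L_1,H\otimes L_2)$ (multipliers of norm at most one) if for every $f\in H\otimes L_1$ the pointwise product $\Phi f$ (that is, $x\mapsto\Phi(x)f(x)$) belongs to $H\otimes L_2$ and $\|\Phi f\|\le\|f\|$. This is equivalent to the operator-valued kernel $(I-\Phi(x)\Phi(y)^* )k(x,y)$ being PSD, i.e. $\sum_{i,j}\langle (I-\Phi(x_i)\Phi(x_j)^* )k(x_i,x_j)v_j,v_i\rangle\ge 0$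 for all finite lists $x_i\in X$, $v_i\in L_2$. For $S\subset X$, $H|_S$ denotes the reproducing kernel Hilbert space on $S$ with kernel $k|_{S\times S}$. The kernel $k$ has the complete Pick property if for all natural numbers $s,t$, whenever $S\subset X$ is finite and $W\in\mathrm{Mult}_1(H|_S\otimes\mathbb{C}^t,H|_S\otimes\mathbb{C}^s)$, there exists $\Phi\in\mathrm{Mult}_1(H\otimes\mathbb{C}^t,H\otimes\mathbb{C}^s)$ such that $\Phi|_S=W$. *)

theory Defs
  imports Complex_Main "Jordan_Normal_Form.Schur_Decomposition"
begin

text \<open>The order on \<^typ>\<open>complex\<close> is the one of \<^theory>\<open>HOL-Library.Complex_Order\<close>:
  \<open>0 \<le> c\<close> says that \<open>c\<close> is real and nonnegative.\<close>

definition psd_mat :: "complex mat \<Rightarrow> bool" where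
  "psd_mat A \<longleftrightarrow>
     square_mat A \<and> mat_adjoint A = A \<and>
     (\<forall>v \<in> carrier_vec (dim_row A). 0 \<le> (A *\<^sub>v v) \<bullet>c v)"

definition psd_kernel :: "'a set \<Rightarrow> ('a \<Rightarrow> 'a \<Rightarrow> complex) \<Rightarrow> bool" where
  "psd_kernel X k \<longleftrightarrow>
     (\<forall>xs. set xs \<subseteq> X \<longrightarrow>
        psd_mat (mat (length xs) (length xs) (\<lambda>(i, j). k (xs ! i) (xs ! j))))"

definition ip_norm :: "(('a \<Rightarrow> complex) \<Rightarrow> ('a \<Rightarrow> complex) \<Rightarrow> complex) \<Rightarrow> ('a \<Rightarrow> complex) \<Rightarrow> real" where
  "ip_norm ip f = sqrt (Re (ip f f))"

text \<open>A function on a set \<open>X\<close> is represented by a total function that vanishes outside \<open>X\<close>,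
  so that equality of functions on \<open>X\<close> is equality in HOL and the vector space operations are
  the pointwise ones. Inner products are linear in the first argument.\<close>

locale hilbert_function_space =
  fixes X :: "'a set"
    and H :: "('a \<Rightarrow> complex) set"
    and ip :: "('a \<Rightarrow> complex) \<Rightarrow> ('a \<Rightarrow> complex) \<Rightarrow> complex"
  assumes vanishes_outside: "\<And>f x. f \<in> H \<Longrightarrow> x \<notin> X \<Longrightarrow> f x = 0"
    and zero_mem: "(\<lambda>x. 0) \<in> H"
    and add_mem: "\<And>f g. f \<in> H \<Longrightarrow> g \<in> H \<Longrightarrow> (\<lambda>x. f x + g x) \<in> H"
    and scale_mem: "\<And>c f. f \<in> H \<Longrightarrow> (\<lambda>x. c * f x) \<in> H"
    and ip_add: "\<And>f g h. f \<in> H \<Longrightarrow> g \<in> H \<Longrightarrow> h \<in> H \<Longrightarrow>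
                   ip (\<lambda>x. f x + g x) h = ip f h + ip g h"
    and ip_scale: "\<And>c f h. f \<in> H \<Longrightarrow> h \<in> H \<Longrightarrow> ip (\<lambda>x. c * f x) h = c * ip f h"
    and ip_cnj: "\<And>f g. f \<in> H \<Longrightarrow> g \<in> H \<Longrightarrow> ip g f = cnj (ip f g)"
    and ip_nonneg: "\<And>f. f \<in> H \<Longrightarrow> 0 \<le> ip f f"
    and ip_definite: "\<And>f. f \<in> H \<Longrightarrow> ip f f = 0 \<Longrightarrow> f = (\<lambda>x. 0)"
    and complete: "\<And>u :: nat \<Rightarrow> 'a \<Rightarrow> complex.
        (\<And>n. u n \<in> H) \<Longrightarrow>
        (\<And>e. e > 0 \<Longrightarrow> \<exists>N. \<forall>m\<ge>N. \<forall>n\<ge>N. ip_norm ip (\<lambda>x. u m x - u n x) < e) \<Longrightarrow>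
        \<exists>f\<in>H. (\<lambda>n. ip_norm ip (\<lambda>x. u n x - f x)) \<longlonglongrightarrow> 0"

definition kernel_fun :: "'a set \<Rightarrow> ('a \<Rightarrow> 'a \<Rightarrow> complex) \<Rightarrow> 'a \<Rightarrow> ('a \<Rightarrow> complex)" where
  "kernel_fun X k y = (\<lambda>x. if x \<in> X then k x y else 0)"

locale rkhs = hilbert_function_space X H ip
  for X :: "'a set"
    and k :: "'a \<Rightarrow> 'a \<Rightarrow> complex"
    and H :: "('a \<Rightarrow> complex) set"
    and ip :: "('a \<Rightarrow> complex) \<Rightarrow> ('a \<Rightarrow> complex) \<Rightarrow> complex" +
  assumes kernel_fun_mem: "\<And>y. y \<in> X \<Longrightarrow> kernel_fun X k y \<in> H"
    and reproducing: "\<And>f y. f \<in> H \<Longrightarrow> y \<in> X \<Longrightarrow> f y = ip f (kernel_fun X k y)"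

text \<open>The tensor product of \<open>H\<close> with complex \<open>t\<close>-space, as vector-valued functions: the element
  \<open>\<Sum>i<t. h\<^sub>i \<otimes> e\<^sub>i\<close>, with \<open>e\<^sub>i\<close> the standard basis, is the function whose \<open>i\<close>-th component
  is \<open>h\<^sub>i\<close>, and its squared norm is the sum of the squared norms of the \<open>h\<^sub>i\<close>.\<close>

definition tensor_vec :: "('a \<Rightarrow> complex) set \<Rightarrow> nat \<Rightarrow> ('a \<Rightarrow> complex vec) set" where
  "tensor_vec H t =
     {f. (\<forall>x. f x \<in> carrier_vec t) \<and> (\<forall>i<t. (\<lambda>x. f x $ i) \<in> H)}"

definition tensor_norm ::
  "(('a \<Rightarrow> complex) \<Rightarrow> ('a \<Rightarrow> complex) \<Rightarrow> complex) \<Rightarrow> nat \<Rightarrow> ('a \<Rightarrow> complex vec) \<Rightarrow> real" where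
  "tensor_norm ip t f = sqrt (\<Sum>i<t. (ip_norm ip (\<lambda>x. f x $ i))\<^sup>2)"

definition pointwise_mult ::
  "'a set \<Rightarrow> nat \<Rightarrow> ('a \<Rightarrow> complex mat) \<Rightarrow> ('a \<Rightarrow> complex vec) \<Rightarrow> ('a \<Rightarrow> complex vec)" where
  "pointwise_mult X s \<Phi> f = (\<lambda>x. if x \<in> X then \<Phi> x *\<^sub>v f x else 0\<^sub>v s)"

text \<open>\<open>mult1 X k t s\<close> is the set of multipliers of norm at most one from the \<open>t\<close>-fold to the
  \<open>s\<close>-fold vector-valued space over the reproducing kernel Hilbert space of \<open>k\<close> on \<open>X\<close>. Operators
  between the coordinate spaces are \<open>s \<times> t\<close> matrices; the values of \<open>\<Phi>\<close> outside \<open>X\<close> are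
  irrelevant. For a positive semi-definite kernel, the pair of \<open>H\<close> and the restriction of \<open>ip\<close>
  to \<open>H\<close> exists and is unique (Moore--Aronszajn), so the existential quantifier selects it.\<close>

definition mult1 ::
  "'a set \<Rightarrow> ('a \<Rightarrow> 'a \<Rightarrow> complex) \<Rightarrow> nat \<Rightarrow> nat \<Rightarrow> ('a \<Rightarrow> complex mat) set" where
  "mult1 X k t s =
     {\<Phi>. (\<forall>x\<in>X. \<Phi> x \<in> carrier_mat s t) \<and>
         (\<exists>H ip. rkhs X k H ip \<and>
            (\<forall>f \<in> tensor_vec H t.
               pointwise_mult X s \<Phi> f \<in> tensor_vec H s \<and>
               tensor_norm ip s (pointwise_mult X s \<Phi> f) \<le> tensor_norm ip t f))}"

definition complete_pick :: "'a set \<Rightarrow> ('a \<Rightarrow> 'a \<Rightarrow> complex) \<Rightarrow> bool" where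
  "complete_pick X k \<longleftrightarrow>
     (\<forall>(s::nat) (t::nat) S W.
        S \<subseteq> X \<longrightarrow> finite S \<longrightarrow> W \<in> mult1 S k t s \<longrightarrow>
        (\<exists>\<Phi> \<in> mult1 X k t s. \<forall>x\<in>S. \<Phi> x = W x))"

end

theory Submission
  imports Defs "HOL-Analysis.L2_Norm"
begin

text \<open>
  Write \<open>F\<^sub>z\<close> for the kernel of the theorem. Two observations drive the proof.

  A contractive multiplier from \<open>H \<otimes> \<complex>\<^sup>n\<close> to \<open>H\<close> maps functions vanishing at \<open>z\<close> to functions
  vanishing at \<open>z\<close>. The subspace of those functions in \<open>H\<close> has the kernel
  \<open>k(x,y) - k(x,z) k(z,y) / k(z,z) = k(x,y) F\<^sub>z(x,y)\<close>. Hence, for a row \<open>\<Phi>\<close> that is a contractive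
  multiplier on \<open>X\<close>, the kernel \<open>(1 - \<Phi>(x) \<Phi>(y)\<^sup>*) k(x,y) F\<^sub>z(x,y)\<close> is positive semi-definite
  (\<open>contractive_row_imp_psd_on\<close>).

  On the other hand, \<open>(1 - F\<^sub>w(x,y)) k(x,y) = k(x,w) k(w,y) / k(w,w)\<close> has rank one. So if \<open>F\<^sub>w\<close> is
  known to be positive on a finite set \<open>S\<close>, and is factored there as \<open>W(x) W(y)\<^sup>*\<close> with row vectors
  \<open>W(x)\<close>, then \<open>W\<close> is a contractive multiplier on \<open>S\<close> (\<open>psd_on_imp_row_mult1\<close>). The complete Pick
  property extends it to \<open>X\<close>, and the first observation says that
  \<open>k(x,w) k(w,y) / k(w,w) \<cdot> F\<^sub>z(x,y)\<close> is positive on \<open>S\<close> for every \<open>z\<close> in \<open>X\<close>. The rank one factor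
  vanishes nowhere and cancels, so \<open>F\<^sub>z\<close> is positive on \<open>S\<close>: positivity on \<open>S\<close> of one \<open>F\<^sub>w\<close> gives
  that of all \<open>F\<^sub>z\<close>.

  This sets up an induction on the number of points. To pass from \<open>S\<close> to \<open>S \<union> {w}\<close>, use the
  induction hypothesis for the new point \<open>w\<close> itself: \<open>F\<^sub>w\<close> is positive on \<open>S\<close>, and its row and column
  at \<open>w\<close> are zero, so it is positive on \<open>S \<union> {w}\<close> (\<open>psd_on_insert_zero\<close>).

  Applying the complete Pick property requires an actual reproducing kernel Hilbert space on a
  finite set, for a kernel matrix that may be singular. It is the span of the columns of a Cholesky
  factor of the kernel, with these columns as an orthonormal basis.
\<close>

section \<open>Positive semi-definite kernels on finite sets\<close>

definition quad_form :: "'a set \<Rightarrow> ('a \<Rightarrow> 'a \<Rightarrow> complex) \<Rightarrow> ('a \<Rightarrow> complex) \<Rightarrow> complex" where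
  "quad_form S K c = (\<Sum>x\<in>S. \<Sum>y\<in>S. cnj (c x) * K x y * c y)"

definition psd_on :: "'a set \<Rightarrow> ('a \<Rightarrow> 'a \<Rightarrow> complex) \<Rightarrow> bool" where
  "psd_on S K \<longleftrightarrow>
     (\<forall>x\<in>S. \<forall>y\<in>S. K y x = cnj (K x y)) \<and> (\<forall>c. 0 \<le> quad_form S K c)"

lemma psd_onI:
  assumes "\<And>x y. x \<in> S \<Longrightarrow> y \<in> S \<Longrightarrow> K y x = cnj (K x y)" and "\<And>c. 0 \<le> quad_form S K c"
  shows "psd_on S K"
  unfolding psd_on_def using assms by blast

lemma psd_on_hermitian: "psd_on S K \<Longrightarrow> x \<in> S \<Longrightarrow> y \<in> S \<Longrightarrow> K y x = cnj (K x y)"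
  unfolding psd_on_def by blast

lemma psd_on_quad_form: "psd_on S K \<Longrightarrow> 0 \<le> quad_form S K c"
  unfolding psd_on_def by blast

lemma quad_form_cong:
  assumes "\<And>x y. x \<in> S \<Longrightarrow> y \<in> S \<Longrightarrow> K x y = L x y" and "\<And>x. x \<in> S \<Longrightarrow> c x = d x"
  shows "quad_form S K c = quad_form S L d"
  unfolding quad_form_def using assms by (intro sum.cong refl) auto

lemma psd_on_cong:
  assumes "\<And>x y. x \<in> S \<Longrightarrow> y \<in> S \<Longrightarrow> K x y = L x y"
  shows "psd_on S K \<longleftrightarrow> psd_on S L"
  unfolding psd_on_def using assms quad_form_cong[of S K L] by auto

lemma quad_form_extend:
  assumes "finite T" "S \<subseteq> T"
  shows "quad_form T K (\<lambda>x. if x \<in> S then c x else 0) = quad_form S K c"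
proof -
  have "quad_form T K (\<lambda>x. if x \<in> S then c x else 0)
      = (\<Sum>x\<in>T. if x \<in> S then (\<Sum>y\<in>T. if y \<in> S then cnj (c x) * K x y * c y else 0) else 0)"
    unfolding quad_form_def by (intro sum.cong refl) (auto intro!: sum.cong)
  also have "\<dots> = quad_form S K c"
    using assms by (simp add: quad_form_def sum.inter_restrict[symmetric] Int_absorb1)
  finally show ?thesis .
qed

lemma psd_on_subset:
  assumes "psd_on T K" "finite T" "S \<subseteq> T"
  shows "psd_on S K"
  using assms quad_form_extend[OF assms(2,3), of K] unfolding psd_on_def by (metis subsetD)

text \<open>Vectors for \<^const>\<open>psd_mat\<close> are indexed by the entries of a list, which may repeat: adding
  up the coefficients that belong to the same point turns such a vector into a function on the set
  of entries with the same quadratic form.\<close>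

lemma quad_form_list:
  fixes p :: "nat \<Rightarrow> 'a"
  shows "quad_form {..<n} (\<lambda>i j. K (p i) (p j)) v
     = quad_form (p ` {..<n}) K (\<lambda>x. \<Sum>i | i \<in> {..<n} \<and> p i = x. v i)"
proof -
  let ?T = "p ` {..<n}"
  let ?c = "\<lambda>x. \<Sum>i | i \<in> {..<n} \<and> p i = x. v i"
  have group: "(\<Sum>i<n. h i) = (\<Sum>x\<in>?T. \<Sum>i | i \<in> {..<n} \<and> p i = x. h i)" for h :: "nat \<Rightarrow> complex"
    by (rule sum.group[symmetric]) auto
  have "(\<Sum>j<n. K x (p j) * v j) = (\<Sum>y\<in>?T. K x y * ?c y)" for x
    unfolding group by (intro sum.cong refl) (auto simp: sum_distrib_left)
  then have "quad_form {..<n} (\<lambda>i j. K (p i) (p j)) v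
      = (\<Sum>i<n. cnj (v i) * (\<Sum>y\<in>?T. K (p i) y * ?c y))"
    unfolding quad_form_def by (simp add: sum_distrib_left[symmetric] mult.assoc)
  also have "\<dots> = (\<Sum>x\<in>?T. cnj (?c x) * (\<Sum>y\<in>?T. K x y * ?c y))"
    unfolding group by (intro sum.cong refl) (auto simp: sum_distrib_right)
  also have "\<dots> = quad_form ?T K ?c"
    unfolding quad_form_def by (simp add: sum_distrib_left mult.assoc)
  finally show ?thesis .
qed

lemma cscalar_prod_mat:
  assumes "v \<in> carrier_vec n"
  shows "(mat n n (\<lambda>(i, j). M i j) *\<^sub>v v) \<bullet>c v = quad_form {..<n} M (\<lambda>i. v $ i)"
  using assms
  by (auto simp: quad_form_def scalar_prod_def sum_distrib_left sum_distrib_right algebra_simps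
        conjugate_complex_def atLeast0LessThan intro!: sum.cong)

lemma psd_mat_iff: "psd_mat (mat n n (\<lambda>(i, j). M i j)) \<longleftrightarrow> psd_on {..<n} M"
proof -
  let ?A = "mat n n (\<lambda>(i, j). M i j)"
  have "mat_adjoint ?A $$ (i, j) = cnj (M j i)" if "i < n" "j < n" for i j
    using that by (simp add: mat_adjoint_def mat_of_rows_def conjugate_complex_def)
  moreover have "dim_row (mat_adjoint ?A) = n" "dim_col (mat_adjoint ?A) = n"
    by (auto simp: mat_adjoint_def)
  ultimately have "mat_adjoint ?A = ?A \<longleftrightarrow> (\<forall>i<n. \<forall>j<n. cnj (M j i) = M i j)"
    by (simp add: mat_eq_iff)
  then have "mat_adjoint ?A = ?A \<longleftrightarrow> (\<forall>x\<in>{..<n}. \<forall>y\<in>{..<n}. M y x = cnj (M x y))"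
    unfolding Ball_def lessThan_iff by metis
  moreover have "(\<forall>v \<in> carrier_vec n. 0 \<le> (?A *\<^sub>v v) \<bullet>c v) \<longleftrightarrow> (\<forall>c. 0 \<le> quad_form {..<n} M c)"
  proof (intro iffI allI ballI)
    fix c assume *: "\<forall>v \<in> carrier_vec n. 0 \<le> (?A *\<^sub>v v) \<bullet>c v"
    have "quad_form {..<n} M c = quad_form {..<n} M (\<lambda>i. vec n c $ i)"
      by (rule quad_form_cong) auto
    also have "\<dots> = (?A *\<^sub>v vec n c) \<bullet>c vec n c"
      by (rule cscalar_prod_mat[symmetric]) simp
    finally show "0 \<le> quad_form {..<n} M c"
      using bspec[OF *, of "vec n c"] by (simp only: vec_carrier)
  qed (simp add: cscalar_prod_mat)
  ultimately show ?thesis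
    by (simp add: psd_mat_def psd_on_def)
qed

lemma psd_kernel_iff_psd_on:
  "psd_kernel X K \<longleftrightarrow> (\<forall>S. finite S \<longrightarrow> S \<subseteq> X \<longrightarrow> psd_on S K)"
proof (intro iffI allI impI)
  fix S assume K: "psd_kernel X K" and S: "finite S" "S \<subseteq> X"
  obtain xs where xs: "distinct xs" "set xs = S"
    using finite_distinct_list S(1) by blast
  let ?n = "length xs"
  have psd: "psd_on {..<?n} (\<lambda>i j. K (xs ! i) (xs ! j))"
    using K S xs by (auto simp: psd_kernel_def psd_mat_iff)
  have img: "(!) xs ` {..<?n} = S"
    using xs(2) by (auto simp: set_conv_nth)
  show "psd_on S K"
  proof (rule psd_onI)
    fix x y assume "x \<in> S" "y \<in> S"
    then obtain i j where "i < ?n" "j < ?n" "x = xs ! i" "y = xs ! j"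
      using img by (metis imageE lessThan_iff)
    then show "K y x = cnj (K x y)"
      using psd_on_hermitian[OF psd, of i j] by simp
  next
    fix c
    have "quad_form S K c = quad_form {..<?n} (\<lambda>i j. K (xs ! i) (xs ! j)) (\<lambda>i. c (xs ! i))"
      unfolding quad_form_def
      by (subst (1 2) sum.reindex_bij_betw[OF bij_betw_nth[OF xs(1) refl xs(2)[symmetric]], symmetric])
        (rule refl)
    then show "0 \<le> quad_form S K c"
      using psd_on_quad_form[OF psd] by simp
  qed
next
  assume *: "\<forall>S. finite S \<longrightarrow> S \<subseteq> X \<longrightarrow> psd_on S K"
  show "psd_kernel X K"
    unfolding psd_kernel_def psd_mat_iff
  proof (intro allI impI)
    fix xs assume "set xs \<subseteq> X"
    let ?n = "length xs"
    have img: "(!) xs ` {..<?n} = set xs"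
      by (auto simp: set_conv_nth)
    have psd: "psd_on (set xs) K"
      using * \<open>set xs \<subseteq> X\<close> by simp
    show "psd_on {..<?n} (\<lambda>i j. K (xs ! i) (xs ! j))"
    proof (rule psd_onI)
      show "0 \<le> quad_form {..<?n} (\<lambda>i j. K (xs ! i) (xs ! j)) c" for c
        unfolding quad_form_list img by (rule psd_on_quad_form[OF psd])
    qed (rule psd_on_hermitian[OF psd]; simp)
  qed
qed

lemma quad_form_factored:
  assumes "\<And>x y. x \<in> S \<Longrightarrow> y \<in> S \<Longrightarrow> K x y = (\<Sum>l<t. e l x * cnj (e l y))"
  shows "quad_form S K c = complex_of_real (\<Sum>l<t. (cmod (\<Sum>x\<in>S. cnj (c x) * e l x))\<^sup>2)"
proof -
  have "quad_form S K c = (\<Sum>x\<in>S. \<Sum>y\<in>S. \<Sum>l<t. (cnj (c x) * e l x) * cnj (cnj (c y) * e l y))"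
    unfolding quad_form_def
    by (intro sum.cong refl) (simp add: assms sum_distrib_left sum_distrib_right algebra_simps)
  also have "\<dots> = (\<Sum>x\<in>S. \<Sum>l<t. \<Sum>y\<in>S. (cnj (c x) * e l x) * cnj (cnj (c y) * e l y))"
    by (intro sum.cong refl sum.swap)
  also have "\<dots> = (\<Sum>l<t. \<Sum>x\<in>S. \<Sum>y\<in>S. (cnj (c x) * e l x) * cnj (cnj (c y) * e l y))"
    by (rule sum.swap)
  also have "\<dots> = (\<Sum>l<t. (\<Sum>x\<in>S. cnj (c x) * e l x) * cnj (\<Sum>x\<in>S. cnj (c x) * e l x))"
    by (simp add: sum_product)
  finally show ?thesis
    unfolding of_real_sum complex_norm_square .
qed

text \<open>Multiplying a kernel by \<open>w\<^sub>l(x) cnj (w\<^sub>l(y))\<close> amounts to twisting the coefficients, which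
  turns the positivity that characterizes contractive rows into an inequality between values of
  one form.\<close>

lemma quad_form_row:
  "quad_form S (\<lambda>x y. (1 - (\<Sum>l<n. w l x * cnj (w l y))) * K x y) c
     = quad_form S K c - (\<Sum>l<n. quad_form S K (\<lambda>x. cnj (w l x) * c x))"
proof -
  have "(\<Sum>l<n. quad_form S K (\<lambda>x. cnj (w l x) * c x))
      = (\<Sum>x\<in>S. \<Sum>l<n. \<Sum>y\<in>S. cnj (cnj (w l x) * c x) * K x y * (cnj (w l y) * c y))"
    unfolding quad_form_def by (rule sum.swap)
  also have "\<dots> = (\<Sum>x\<in>S. \<Sum>y\<in>S. \<Sum>l<n. cnj (cnj (w l x) * c x) * K x y * (cnj (w l y) * c y))"
    by (intro sum.cong refl sum.swap)
  also have "\<dots> = (\<Sum>x\<in>S. \<Sum>y\<in>S. cnj (c x) * ((\<Sum>l<n. w l x * cnj (w l y)) * K x y) * c y)"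
    by (intro sum.cong refl) (simp add: sum_distrib_left sum_distrib_right algebra_simps)
  finally show ?thesis
    by (simp add: quad_form_def sum_subtractf[symmetric] algebra_simps)
qed

lemma psd_on_rank_one: "psd_on S (\<lambda>x y. g x * cnj (g y))"
proof (rule psd_onI)
  show "0 \<le> quad_form S (\<lambda>x y. g x * cnj (g y)) c" for c
    by (subst quad_form_factored[where t = "Suc 0" and e = "\<lambda>_. g"]) (auto simp: less_eq_complex_def)
qed auto

lemma psd_on_rescale:
  assumes "psd_on S (\<lambda>x y. g x * cnj (g y) * K x y)" and "\<And>x. x \<in> S \<Longrightarrow> g x \<noteq> 0"
  shows "psd_on S K"
proof (rule psd_onI)
  fix x y assume xy: "x \<in> S" "y \<in> S"
  then have "g y * cnj (g x) * K y x = g y * cnj (g x) * cnj (K x y)"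
    using psd_on_hermitian[OF assms(1) xy] by (simp add: algebra_simps)
  then show "K y x = cnj (K x y)"
    using assms(2) xy by simp
next
  fix c
  have "quad_form S K c = quad_form S (\<lambda>x y. g x * cnj (g y) * K x y) (\<lambda>x. c x / cnj (g x))"
    unfolding quad_form_def using assms(2) by (intro sum.cong refl) simp
  then show "0 \<le> quad_form S K c"
    using psd_on_quad_form[OF assms(1)] by simp
qed

lemma psd_on_insert_zero:
  assumes "psd_on S K" "finite S" "\<And>x. x \<in> insert a S \<Longrightarrow> K x a = 0" "\<And>x. x \<in> insert a S \<Longrightarrow> K a x = 0"
  shows "psd_on (insert a S) K"
proof (rule psd_onI)
  show "K y x = cnj (K x y)" if "x \<in> insert a S" "y \<in> insert a S" for x y
    using that assms(3,4) psd_on_hermitian[OF assms(1), of x y] by (cases "x = a"; cases "y = a") auto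
next
  fix c
  have "quad_form (insert a S) K c = quad_form S K c"
  proof (cases "a \<in> S")
    case True then show ?thesis by (simp add: insert_absorb)
  next
    case False
    then show ?thesis using assms(2-4) by (simp add: quad_form_def)
  qed
  then show "0 \<le> quad_form (insert a S) K c"
    using psd_on_quad_form[OF assms(1)] by simp
qed

section \<open>Cholesky factorization\<close>

lemma quad_form_insert:
  assumes "finite S" "a \<notin> S" and herm: "\<And>x. x \<in> S \<Longrightarrow> K x a = cnj (K a x)"
  defines "b \<equiv> \<lambda>c. \<Sum>y\<in>S. K a y * c y"
  shows "quad_form (insert a S) K c
    = quad_form S K c + cnj (b c) * c a + cnj (c a) * b c + cnj (c a) * K a a * c a"
proof -
  have "cnj (b c) * c a = (\<Sum>x\<in>S. cnj (c x) * K x a * c a)"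
    using herm unfolding b_def by (simp add: sum_distrib_left sum_distrib_right algebra_simps)
  moreover have "cnj (c a) * b c = (\<Sum>y\<in>S. cnj (c a) * K a y * c y)"
    unfolding b_def by (simp add: sum_distrib_left algebra_simps)
  ultimately show ?thesis
    using assms(1,2) by (simp add: quad_form_def sum.distrib algebra_simps)
qed

lemma psd_on_diag:
  assumes "psd_on S K" "finite S" "a \<in> S"
  shows "0 \<le> K a a"
  using psd_on_quad_form[OF psd_on_subset[OF assms(1,2), of "{a}"], of "\<lambda>_. 1"] assms(3)
  by (simp add: quad_form_def)

lemma psd_on_zero_diag:
  assumes "psd_on S K" "finite S" "a \<in> S" "x \<in> S" "K a a = 0"
  shows "K a x = 0"
proof (rule ccontr)
  assume nz: "K a x \<noteq> 0"
  then have ne: "x \<noteq> a"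
    using assms(5) by auto
  define q where "q = (cmod (K a x))\<^sup>2"
  have "q > 0"
    using nz by (simp add: q_def)
  \<comment> \<open>The form on the two points is affine in \<open>c a\<close>, so a large multiple of \<open>- K a x\<close> makes it negative.\<close>
  define r where "r = (Re (K x x) + 1) / q"
  define c where "c = (\<lambda>y. if y = a then - (complex_of_real r * K a x) else 1)"
  have "quad_form {a, x} K c = K x x + cnj (K a x) * c a + cnj (c a) * K a x"
    using quad_form_insert[of "{x}" a K c] ne assms(5) psd_on_hermitian[OF assms(1,3,4)]
    by (simp add: quad_form_def c_def)
  moreover have "cnj (K a x) * c a + cnj (c a) * K a x = - (2 * complex_of_real r * complex_of_real q)"
    by (simp add: c_def q_def complex_norm_square algebra_simps del: of_real_power)
  ultimately have "quad_form {a, x} K c = K x x - complex_of_real (2 * r * q)"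
    by (simp add: add.assoc)
  moreover have "0 \<le> quad_form {a, x} K c"
    using psd_on_quad_form[OF psd_on_subset[OF assms(1,2)]] assms(3,4) by simp
  ultimately have "2 * (r * q) \<le> Re (K x x)"
    by (simp add: less_eq_complex_def)
  moreover have "r * q = Re (K x x) + 1"
    using \<open>q > 0\<close> by (simp add: r_def)
  moreover have "0 \<le> Re (K x x)"
    using psd_on_diag[OF assms(1,2,4)] by (simp add: less_eq_complex_def)
  ultimately show False by simp
qed

text \<open>If \<open>K a a = 0\<close>, the correction term is zero by the convention for division by zero, and
  the claim reduces to restriction.\<close>

lemma psd_on_schur_complement:
  assumes psd: "psd_on (insert a S) K" and "finite S" "a \<notin> S"
  shows "psd_on S (\<lambda>x y. K x y - K x a * K a y / K a a)"
proof (cases "K a a = 0")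
  case True
  then show ?thesis
    using psd_on_subset[OF psd, of S] assms(2) by auto
next
  case False
  note herm = psd_on_hermitian[OF psd]
  have real: "cnj (K a a) = K a a"
    using herm[of a a] by simp
  have herm': "K x a = cnj (K a x)" if "x \<in> S" for x
    using herm[of a x] that by simp
  show ?thesis
  proof (rule psd_onI)
    show "K y x - K y a * K a x / K a a = cnj (K x y - K x a * K a y / K a a)"
      if "x \<in> S" "y \<in> S" for x y
      using that herm[of x y] herm'[of x] herm'[of y] real by simp
  next
    fix c
    define b where "b = (\<Sum>y\<in>S. K a y * c y)"
    \<comment> \<open>The value at \<open>a\<close> minimizes the form.\<close>
    define c' where "c' = c(a := - b / K a a)"
    have b': "(\<Sum>y\<in>S. K a y * c' y) = b"
      unfolding b_def c'_def using assms(3) by (intro sum.cong) auto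
    have "quad_form S K c' = quad_form S K c"
      using assms(3) by (intro quad_form_cong) (auto simp: c'_def)
    then have "quad_form (insert a S) K c'
        = quad_form S K c + cnj b * c' a + cnj (c' a) * b + cnj (c' a) * K a a * c' a"
      using quad_form_insert[where K = K and c = c', OF assms(2,3) herm'] by (simp only: b')
    also have "\<dots> = quad_form S K c - cnj b * b / K a a"
    proof -
      have "c' a = - (b / K a a)" "cnj (c' a) = - (cnj b / K a a)"
        using real by (simp_all add: c'_def)
      then show ?thesis
        using False by (simp only:) simp
    qed
    finally have "quad_form (insert a S) K c' = quad_form S K c - cnj b * b / K a a" .
    also have "cnj b * b / K a a = (\<Sum>x\<in>S. \<Sum>y\<in>S. cnj (c x) * (K x a * K a y / K a a) * c y)"
      unfolding b_def
      by (simp add: sum_product sum_divide_distrib) (auto intro!: sum.cong simp: herm' algebra_simps)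
    also have "quad_form S K c - \<dots> = quad_form S (\<lambda>x y. K x y - K x a * K a y / K a a) c"
      by (simp add: quad_form_def sum_subtractf algebra_simps)
    finally show "0 \<le> quad_form S (\<lambda>x y. K x y - K x a * K a y / K a a) c"
      using psd_on_quad_form[OF psd, of c'] by simp
  qed
qed

text \<open>One elimination step per point with a nonzero pivot gives a triangular, hence independent,
  family \<open>e\<close>. Independence is recorded by the dual functionals \<open>d\<close>: they make coordinates with
  respect to \<open>e\<close> linear functions of the values, defined on all functions and not only on the
  span.\<close>

lemma psd_on_factorization:
  assumes "finite S" "psd_on S K"
  shows "\<exists>t (e :: nat \<Rightarrow> 'a \<Rightarrow> complex) d.
    (\<forall>x\<in>S. \<forall>y\<in>S. K x y = (\<Sum>l<t. e l x * cnj (e l y))) \<and>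
    (\<forall>l<t. \<forall>m<t. (\<Sum>x\<in>S. d l x * e m x) = (if l = m then 1 else 0))"
  using assms
proof (induction S arbitrary: K rule: finite_induct)
  case empty
  show ?case by (intro exI[of _ 0]) simp
next
  case (insert a S)
  let ?K' = "\<lambda>x y. K x y - K x a * K a y / K a a"
  obtain t and e d :: "nat \<Rightarrow> 'a \<Rightarrow> complex" where e: "\<And>x y. x \<in> S \<Longrightarrow> y \<in> S \<Longrightarrow> ?K' x y = (\<Sum>l<t. e l x * cnj (e l y))"
    and d: "\<And>l m. l < t \<Longrightarrow> m < t \<Longrightarrow> (\<Sum>x\<in>S. d l x * e m x) = (if l = m then 1 else 0)"
    using insert.IH[OF psd_on_schur_complement[OF insert.prems insert.hyps]] by blast
  note herm = psd_on_hermitian[OF insert.prems]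
  have pos: "0 \<le> K a a"
    using psd_on_diag[OF insert.prems] insert.hyps by simp
  define s where "s = complex_of_real (sqrt (Re (K a a)))"
  have "Re (K a a) \<ge> 0" and "K a a = complex_of_real (Re (K a a))"
    using pos by (auto simp: less_eq_complex_def complex_eq_iff)
  then have s2: "s * s = K a a" and s_real: "cnj s = s"
    unfolding s_def by (auto simp flip: of_real_mult)
  \<comment> \<open>The new column vanishes exactly when the pivot is zero, and is then not included (\<open>u = t\<close>).
    The earlier columns vanish at \<open>a\<close>, so evaluation at \<open>a\<close> is dual to the new one.\<close>
  define e' where "e' = (\<lambda>l x. if l < t then (if x = a then 0 else e l x) else K x a / s)"
  define u where "u = (if K a a = 0 then t else Suc t)"
  define dt where "dt = (\<lambda>x. if x = a then 1 / s else 0)"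
  define r where "r = (\<lambda>l. \<Sum>x\<in>S. d l x * e' t x)"
  \<comment> \<open>The earlier functionals are corrected to annihilate the new column.\<close>
  define d' where "d' = (\<lambda>l x. if l < t then (if x = a then 0 else d l x) - r l * dt x else dt x)"
  have e'_S: "(\<Sum>x\<in>S. d l x * e' m x) = (\<Sum>x\<in>S. d l x * e m x)" if "m < t" for l m
    using that insert.hyps by (intro sum.cong) (auto simp: e'_def)
  have low: "(\<Sum>l<t. e' l x * cnj (e' l y)) = ?K' x y"
    if "x \<in> insert a S" "y \<in> insert a S" for x y
  proof (cases "x = a \<or> y = a")
    case True
    then have "(\<Sum>l<t. e' l x * cnj (e' l y)) = 0"
      by (intro sum.neutral) (auto simp: e'_def)
    moreover have "K a a = 0 \<Longrightarrow> K a w = 0 \<and> K w a = 0" if "w \<in> insert a S" for w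
      using psd_on_zero_diag[OF insert.prems, of a w] herm[of a w] that insert.hyps by simp
    then have "?K' x y = 0"
      using True that by (cases "K a a = 0") auto
    ultimately show ?thesis by simp
  next
    case False
    then have "(\<Sum>l<t. e' l x * cnj (e' l y)) = (\<Sum>l<t. e l x * cnj (e l y))"
      by (intro sum.cong) (auto simp: e'_def)
    then show ?thesis using e[of x y] False that by simp
  qed
  have K_eq: "K x y = (\<Sum>l<u. e' l x * cnj (e' l y))" if xy: "x \<in> insert a S" "y \<in> insert a S" for x y
  proof (cases "K a a = 0")
    case True then show ?thesis using low[OF xy] by (simp add: u_def)
  next
    case False
    have "e' t x * cnj (e' t y) = K x a * K a y / K a a"
      using herm[of a y] xy s_real s2 by (simp add: e'_def)
    then show ?thesis using low[OF xy] False by (simp add: u_def)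
  qed
  have dt_e': "(\<Sum>x\<in>insert a S. dt x * f x) = f a / s" for f
    using insert.hyps by (simp add: dt_def) (intro sum.neutral, auto)
  have dual: "(\<Sum>x\<in>insert a S. d' l x * e' m x) = (if l = m then 1 else 0)" if lm: "l < u" "m < u" for l m
  proof -
    have s0: "s \<noteq> 0" if "l = t \<or> m = t"
      using that lm s2 by (auto simp: u_def split: if_splits)
    have e't: "e' t a / s = 1" if "l = t \<or> m = t"
      using s0[OF that] by (simp add: e'_def divide_simps flip: s2)
    have le: "l \<le> t" "m \<le> t"
      using lm by (auto simp: u_def split: if_splits)
    have e'0: "e' m a = 0" if "m < t"
      using that by (simp add: e'_def)
    show ?thesis
    proof (cases "l < t")
      case True
      have "(\<Sum>x\<in>insert a S. d' l x * e' m x)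
          = (\<Sum>x\<in>insert a S. (if x = a then 0 else d l x) * e' m x) - r l * (\<Sum>x\<in>insert a S. dt x * e' m x)"
        using True by (simp only: d'_def sum_distrib_left if_True) (simp only: left_diff_distrib sum_subtractf mult.assoc)
      also have "(\<Sum>x\<in>insert a S. (if x = a then 0 else d l x) * e' m x) = (\<Sum>x\<in>S. d l x * e' m x)"
        using insert.hyps by simp (intro sum.cong, auto)
      also have "(\<Sum>x\<in>insert a S. dt x * e' m x) = e' m a / s"
        by (rule dt_e')
      finally have *: "(\<Sum>x\<in>insert a S. d' l x * e' m x) = (\<Sum>x\<in>S. d l x * e' m x) - r l * (e' m a / s)" .
      show ?thesis
      proof (cases "m < t")
        case True
        then show ?thesis using * e'0 e'_S d[of l m] \<open>l < t\<close> by simp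
      next
        case False
        then have "m = t" using le by simp
        then show ?thesis using * e't \<open>l < t\<close> by (simp add: r_def)
      qed
    next
      case False
      then have "l = t" using le by simp
      have "(\<Sum>x\<in>insert a S. d' l x * e' m x) = e' m a / s"
        using False by (simp only: d'_def if_False dt_e')
      then show ?thesis using e'0 e't \<open>l = t\<close> le by (cases "m < t") auto
    qed
  qed
  show ?case
    by (intro exI[of _ u] exI[of _ e'] exI[of _ d'] conjI ballI allI impI) (rule K_eq dual; assumption)+
qed

section \<open>Hilbert function spaces\<close>

context hilbert_function_space
begin

lemma ip_zero_left: "g \<in> H \<Longrightarrow> ip (\<lambda>x. 0) g = 0"
  using ip_scale[of "\<lambda>x. 0" g 0] zero_mem by simp

lemma lincomb:
  assumes "finite A" "\<And>i. i \<in> A \<Longrightarrow> f i \<in> H"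
  shows lincomb_mem: "(\<lambda>x. \<Sum>i\<in>A. c i * f i x) \<in> H"
    and ip_lincomb_left: "g \<in> H \<Longrightarrow> ip (\<lambda>x. \<Sum>i\<in>A. c i * f i x) g = (\<Sum>i\<in>A. c i * ip (f i) g)"
proof -
  have "(\<lambda>x. \<Sum>i\<in>A. c i * f i x) \<in> H \<and>
    (g \<in> H \<longrightarrow> ip (\<lambda>x. \<Sum>i\<in>A. c i * f i x) g = (\<Sum>i\<in>A. c i * ip (f i) g))" for g
    using assms
  proof (induction A rule: finite_induct)
    case empty
    then show ?case using zero_mem ip_zero_left by simp
  next
    case (insert i A)
    then have "f i \<in> H" "(\<lambda>x. \<Sum>j\<in>A. c j * f j x) \<in> H"
      by auto
    then show ?case
      using insert ip_add[of "\<lambda>x. c i * f i x" "\<lambda>x. \<Sum>j\<in>A. c j * f j x" g]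
      by (simp add: add_mem scale_mem ip_scale)
  qed
  then show "(\<lambda>x. \<Sum>i\<in>A. c i * f i x) \<in> H"
    and "g \<in> H \<Longrightarrow> ip (\<lambda>x. \<Sum>i\<in>A. c i * f i x) g = (\<Sum>i\<in>A. c i * ip (f i) g)"
    by auto
qed

lemma ip_lincomb_right:
  assumes "finite A" "\<And>i. i \<in> A \<Longrightarrow> f i \<in> H" "g \<in> H"
  shows "ip g (\<lambda>x. \<Sum>i\<in>A. c i * f i x) = (\<Sum>i\<in>A. cnj (c i) * ip g (f i))"
proof -
  have "ip g (\<lambda>x. \<Sum>i\<in>A. c i * f i x) = cnj (ip (\<lambda>x. \<Sum>i\<in>A. c i * f i x) g)"
    using assms by (intro ip_cnj lincomb_mem) auto
  also have "\<dots> = (\<Sum>i\<in>A. cnj (c i) * cnj (ip (f i) g))"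
    by (subst ip_lincomb_left[OF assms]) auto
  also have "\<dots> = (\<Sum>i\<in>A. cnj (c i) * ip g (f i))"
    using assms by (intro sum.cong refl) (simp add: ip_cnj[of "f _" g])
  finally show ?thesis .
qed

lemma ip_real: "f \<in> H \<Longrightarrow> ip f f = complex_of_real (Re (ip f f))"
  using ip_nonneg[of f] by (simp add: less_eq_complex_def complex_eq_iff)

lemma Cauchy_Schwarz:
  assumes f: "f \<in> H" and g: "g \<in> H"
  shows "(cmod (ip f g))\<^sup>2 \<le> Re (ip f f) * Re (ip g g)"
proof (cases "ip g g = 0")
  case True
  then have "ip g f = 0"
    using ip_definite[OF g True] ip_zero_left[OF f] by simp
  then show ?thesis
    using True ip_cnj[OF g f] by simp
next
  case False
  have pos: "Re (ip g g) > 0"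
    using False ip_nonneg[OF g] by (auto simp: less_eq_complex_def complex_eq_iff)
  \<comment> \<open>\<open>h\<close> is the component of \<open>f\<close> orthogonal to \<open>g\<close>.\<close>
  define a where "a = ip f g / ip g g"
  define h where "h = (\<lambda>x. f x + (- a) * g x)"
  have ag: "(\<lambda>x. (- a) * g x) \<in> H"
    by (rule scale_mem[OF g])
  have h: "h \<in> H"
    unfolding h_def by (rule add_mem[OF f ag])
  have ip_h: "ip h v = ip f v - a * ip g v" if "v \<in> H" for v
    using ip_add[OF f ag that] ip_scale[OF g that, of "- a"] by (simp add: h_def)
  have "ip h g = 0"
    using ip_h[OF g] False by (simp add: a_def)
  then have "ip g h = 0"
    using ip_cnj[OF h g] by simp
  then have "ip h h = ip f h"
    using ip_h[OF h] by simp
  also have "\<dots> = cnj (ip f f - a * ip g f)"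
    using ip_cnj[OF h f] ip_h[OF f] by simp
  finally have "0 \<le> Re (ip f f) - Re (a * ip g f)"
    using ip_nonneg[OF h] by (simp add: less_eq_complex_def)
  also have "a * ip g f = complex_of_real ((cmod (ip f g))\<^sup>2 / Re (ip g g))"
    unfolding a_def of_real_divide complex_norm_square ip_real[OF g, symmetric] ip_cnj[OF f g]
    by simp
  finally show ?thesis
    using pos by (simp add: field_simps)
qed

lemma ip_norm_power2: "f \<in> H \<Longrightarrow> (ip_norm ip f)\<^sup>2 = Re (ip f f)"
  using ip_nonneg[of f] by (simp add: ip_norm_def less_eq_complex_def)

end

section \<open>Row multipliers\<close>

definition row_mult :: "'a set \<Rightarrow> nat \<Rightarrow> (nat \<Rightarrow> 'a \<Rightarrow> complex) \<Rightarrow> (nat \<Rightarrow> 'a \<Rightarrow> complex) \<Rightarrow> 'a \<Rightarrow> complex"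
  where "row_mult X n w f = (\<lambda>x. if x \<in> X then \<Sum>l<n. w l x * f l x else 0)"

text \<open>Membership in \<^const>\<open>mult1\<close> for row matrices, with tuples of scalar functions in place of
  functions with values in coordinate spaces.\<close>

definition contractive_row where
  "contractive_row X H ip n w \<longleftrightarrow>
     (\<forall>f. (\<forall>l<n. f l \<in> H) \<longrightarrow> row_mult X n w f \<in> H \<and>
        Re (ip (row_mult X n w f) (row_mult X n w f)) \<le> (\<Sum>l<n. Re (ip (f l) (f l))))"

lemma (in hilbert_function_space) contractive_row_iff:
  assumes "\<And>x. x \<in> X \<Longrightarrow> \<Phi> x \<in> carrier_mat 1 n"
  shows "(\<forall>f \<in> tensor_vec H n. pointwise_mult X 1 \<Phi> f \<in> tensor_vec H 1 \<and>
            tensor_norm ip 1 (pointwise_mult X 1 \<Phi> f) \<le> tensor_norm ip n f)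
     \<longleftrightarrow> contractive_row X H ip n (\<lambda>l x. \<Phi> x $$ (0, l))"
    (is "(\<forall>f\<in>?T. ?P f) \<longleftrightarrow> _")
proof -
  let ?w = "\<lambda>l x. \<Phi> x $$ (0, l)"
  let ?Q = "\<lambda>f. row_mult X n ?w f \<in> H \<and>
        Re (ip (row_mult X n ?w f) (row_mult X n ?w f)) \<le> (\<Sum>l<n. Re (ip (f l) (f l)))"
  have eq: "?P F \<longleftrightarrow> ?Q f"
    if F: "\<And>x. F x \<in> carrier_vec n" and f: "\<And>l. l < n \<Longrightarrow> f l = (\<lambda>x. F x $ l)"
      and fH: "\<And>l. l < n \<Longrightarrow> f l \<in> H" for F f
  proof -
    have carrier: "pointwise_mult X 1 \<Phi> F x \<in> carrier_vec 1" for x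
      using mult_mat_vec_carrier[OF assms F] by (simp add: pointwise_mult_def)
    have comp: "(\<lambda>x. pointwise_mult X 1 \<Phi> F x $ 0) = row_mult X n ?w f"
    proof
      fix x
      show "pointwise_mult X 1 \<Phi> F x $ 0 = row_mult X n ?w f x"
        using assms[of x] F[of x] f
        by (auto simp: pointwise_mult_def row_mult_def scalar_prod_def atLeast0LessThan
            intro!: sum.cong)
    qed
    have mem: "pointwise_mult X 1 \<Phi> F \<in> tensor_vec H 1 \<longleftrightarrow> row_mult X n ?w f \<in> H"
      using carrier comp by (simp add: tensor_vec_def)
    have "(\<Sum>l<n. (ip_norm ip (\<lambda>x. F x $ l))\<^sup>2) = (\<Sum>l<n. Re (ip (f l) (f l)))"
      using f fH by (intro sum.cong refl) (simp add: ip_norm_power2)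
    then have "tensor_norm ip 1 (pointwise_mult X 1 \<Phi> F) \<le> tensor_norm ip n F \<longleftrightarrow>
        Re (ip (row_mult X n ?w f) (row_mult X n ?w f)) \<le> (\<Sum>l<n. Re (ip (f l) (f l)))"
      if "row_mult X n ?w f \<in> H"
      using ip_norm_power2[OF that] comp by (simp add: tensor_norm_def del: real_sqrt_abs)
    then show ?thesis
      using mem by blast
  qed
  show ?thesis
  proof
    assume P: "\<forall>f\<in>?T. ?P f"
    show "contractive_row X H ip n ?w"
      unfolding contractive_row_def
    proof (intro allI impI)
      fix f assume f: "\<forall>l<n. f l \<in> H"
      let ?F = "\<lambda>x. vec n (\<lambda>l. f l x)"
      have "?F \<in> ?T"
        using f by (auto simp: tensor_vec_def)
      then show "?Q f"
        using P eq[of ?F f] f by auto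
    qed
  next
    assume Q: "contractive_row X H ip n ?w"
    show "\<forall>f\<in>?T. ?P f"
    proof
      fix F assume "F \<in> ?T"
      then have F: "\<And>x. F x \<in> carrier_vec n" "\<And>l. l < n \<Longrightarrow> (\<lambda>x. F x $ l) \<in> H"
        by (auto simp: tensor_vec_def)
      have "?Q (\<lambda>l x. F x $ l)"
        using Q F(2) by (simp add: contractive_row_def)
      then show "?P F"
        using eq[OF F(1) refl F(2)] by blast
    qed
  qed
qed

lemma mult1_row_iff:
  assumes "\<And>x. x \<in> X \<Longrightarrow> \<Phi> x \<in> carrier_mat 1 n"
  shows "\<Phi> \<in> mult1 X k n 1 \<longleftrightarrow>
    (\<exists>H ip. rkhs X k H ip \<and> contractive_row X H ip n (\<lambda>l x. \<Phi> x $$ (0, l)))"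
proof -
  have "\<Phi> \<in> mult1 X k n 1 \<longleftrightarrow> (\<exists>H ip. rkhs X k H ip \<and>
      (\<forall>f \<in> tensor_vec H n. pointwise_mult X 1 \<Phi> f \<in> tensor_vec H 1 \<and>
            tensor_norm ip 1 (pointwise_mult X 1 \<Phi> f) \<le> tensor_norm ip n f))"
    using assms by (simp add: mult1_def)
  also have "\<dots> \<longleftrightarrow> (\<exists>H ip. rkhs X k H ip \<and> contractive_row X H ip n (\<lambda>l x. \<Phi> x $$ (0, l)))"
    by (intro ex_cong1 conj_cong refl)
      (rule hilbert_function_space.contractive_row_iff[OF rkhs.axioms(1)], assumption, rule assms)
  finally show ?thesis .
qed

text \<open>The function \<open>v x\<close> below is the projection of the kernel function at \<open>x\<close> to the functions
  vanishing at \<open>z\<close>, and the multiplier preserves this subspace. For \<open>G = \<Sum>\<^sub>x c(x) v\<^sub>x\<close>, the adjoint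
  of the multiplier, compressed to the subspace, sends \<open>G\<close> to the tuple of the
  \<open>f\<^sub>l = \<Sum>\<^sub>x c(x) cnj (w\<^sub>l(x)) v\<^sub>x\<close>. Pairing the image \<open>h\<close> of this tuple with \<open>G\<close> gives
  \<open>\<Sum>\<^sub>l \<parallel>f\<^sub>l\<parallel>\<^sup>2 \<le> \<parallel>G\<parallel>\<^sup>2\<close>, which is the claim, without forming an adjoint.\<close>

lemma (in rkhs) contractive_row_imp_psd_on:
  assumes w: "contractive_row X H ip n w" and z: "z \<in> X" "k z z \<noteq> 0" and S: "finite S" "S \<subseteq> X"
  shows "psd_on S (\<lambda>x y. (1 - (\<Sum>l<n. w l x * cnj (w l y))) * (k x y - k x z * k z y / k z z))"
proof -
  let ?\<kappa> = "\<lambda>x y. k x y - k x z * k z y / k z z"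
  define v where "v x = (\<lambda>u. kernel_fun X k x u + (- (k z x / k z z)) * kernel_fun X k z u)" for x
  have kz: "(\<lambda>u. c * kernel_fun X k z u) \<in> H" for c
    using z kernel_fun_mem scale_mem by blast
  have v_mem: "v x \<in> H" if "x \<in> X" for x
    unfolding v_def using that by (intro add_mem kernel_fun_mem kz)
  have v_eq: "v y x = ?\<kappa> x y" if "x \<in> X" for x y
    using that z by (simp add: v_def kernel_fun_def)
  have v_z: "v x z = 0" for x
    using z by (simp add: v_eq)
  have ip_v: "ip f (v x) = f x" if f: "f \<in> H" "f z = 0" and x: "x \<in> X" for f x
  proof -
    have "ip (v x) f = ip (kernel_fun X k x) f + (- (k z x / k z z)) * ip (kernel_fun X k z) f"
      unfolding v_def
      by (simp only: ip_add[OF kernel_fun_mem[OF x] kz f(1)] ip_scale[OF kernel_fun_mem[OF z(1)] f(1)])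
    also have "ip (kernel_fun X k z) f = 0"
      using ip_cnj[OF f(1) kernel_fun_mem[OF z(1)]] reproducing[OF f(1) z(1)] f(2) by simp
    also have "ip (kernel_fun X k x) f = cnj (f x)"
      using ip_cnj[OF f(1) kernel_fun_mem[OF x]] reproducing[OF f(1) x] by simp
    finally show ?thesis
      using ip_cnj[OF v_mem[OF x] f(1)] by simp
  qed
  define comb where "comb c = (\<lambda>u. \<Sum>y\<in>S. c y * v y u)" for c
  have comb_mem: "comb c \<in> H" for c
    unfolding comb_def using S v_mem by (intro lincomb_mem) auto
  have comb_z: "comb c z = 0" for c
    by (simp add: comb_def v_z)
  have ip_comb: "ip f (comb c) = (\<Sum>x\<in>S. cnj (c x) * f x)" if "f \<in> H" "f z = 0" for f c
  proof -
    have "ip f (comb c) = (\<Sum>x\<in>S. cnj (c x) * ip f (v x))"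
      unfolding comb_def using S v_mem that by (intro ip_lincomb_right) auto
    then show ?thesis
      using S ip_v[OF that] by (simp add: subset_iff)
  qed
  have comb_eq: "comb c x = (\<Sum>y\<in>S. ?\<kappa> x y * c y)" if "x \<in> S" for c x
    using that S unfolding comb_def by (intro sum.cong refl) (auto simp: v_eq)
  have norm_comb: "ip (comb c) (comb c) = quad_form S ?\<kappa> c" for c
    unfolding ip_comb[OF comb_mem comb_z] quad_form_def
    by (intro sum.cong refl) (simp add: comb_eq sum_distrib_left mult.assoc)
  have ip_kernel: "ip (kernel_fun X k y) (kernel_fun X k x) = k x y" if "x \<in> X" "y \<in> X" for x y
    using reproducing[OF kernel_fun_mem[OF that(2)] that(1), symmetric] that(1)
    by (simp only: kernel_fun_def if_True)
  have herm: "k y x = cnj (k x y)" if "x \<in> X" "y \<in> X" for x y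
    using ip_cnj[OF kernel_fun_mem[OF that(2)] kernel_fun_mem[OF that(1)]] ip_kernel that by simp
  show ?thesis
  proof (rule psd_onI)
    fix x y assume "x \<in> S" "y \<in> S"
    then have xy: "x \<in> X" "y \<in> X"
      using S by auto
    have "?\<kappa> y x = cnj (?\<kappa> x y)"
      using herm[OF xy] herm[OF xy(1) z(1)] herm[OF z(1) xy(1)] herm[OF z(1) xy(2)] herm[OF xy(2) z(1)] herm[OF z(1) z(1)]
      by (simp add: mult.commute)
    then show "(1 - (\<Sum>l<n. w l y * cnj (w l x))) * ?\<kappa> y x = cnj ((1 - (\<Sum>l<n. w l x * cnj (w l y))) * ?\<kappa> x y)"
      by (simp add: mult.commute)
  next
    fix c
    define f where "f l = comb (\<lambda>y. cnj (w l y) * c y)" for l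
    define h where "h = row_mult X n w f"
    define A where "A = (\<Sum>l<n. Re (ip (f l) (f l)))"
    have f: "f l \<in> H" for l
      by (simp add: f_def comb_mem)
    then have h: "h \<in> H" "Re (ip h h) \<le> A"
      using w unfolding contractive_row_def h_def A_def by auto
    have sum_f: "(\<Sum>l<n. quad_form S ?\<kappa> (\<lambda>x. cnj (w l x) * c x)) = complex_of_real A"
      unfolding A_def of_real_sum ip_real[OF f, symmetric] by (simp add: f_def norm_comb)
    have "h z = 0"
      by (simp add: h_def row_mult_def f_def comb_z)
    then have "ip h (comb c) = (\<Sum>x\<in>S. cnj (c x) * h x)"
      by (rule ip_comb[OF h(1)])
    also have "\<dots> = (\<Sum>x\<in>S. \<Sum>l<n. cnj (cnj (w l x) * c x) * f l x)"
      using S by (intro sum.cong refl) (auto simp: h_def row_mult_def sum_distrib_left algebra_simps)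
    also have "\<dots> = (\<Sum>l<n. \<Sum>x\<in>S. cnj (cnj (w l x) * c x) * f l x)"
      by (rule sum.swap)
    also have "\<dots> = (\<Sum>l<n. ip (f l) (f l))"
      using ip_comb[OF comb_mem comb_z] by (simp add: f_def)
    also have "\<dots> = complex_of_real A"
      unfolding A_def of_real_sum ip_real[OF f, symmetric] ..
    finally have "A\<^sup>2 \<le> Re (ip h h) * Re (ip (comb c) (comb c))"
      using Cauchy_Schwarz[OF h(1) comb_mem, of c] by simp
    moreover have nonneg: "0 \<le> Re (ip (comb c) (comb c))"
      using ip_nonneg[OF comb_mem] by (simp add: less_eq_complex_def)
    ultimately have "A * A \<le> A * Re (ip (comb c) (comb c))"
      using mult_right_mono[OF h(2) nonneg] by (simp add: power2_eq_square)
    then have "A \<le> Re (ip (comb c) (comb c))"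
      using nonneg by (cases "A > 0") auto
    moreover have "quad_form S ?\<kappa> c = complex_of_real (Re (ip (comb c) (comb c)))"
      using ip_real[OF comb_mem, of c] norm_comb by simp
    ultimately show "0 \<le> quad_form S (\<lambda>x y. (1 - (\<Sum>l<n. w l x * cnj (w l y))) * ?\<kappa> x y) c"
      unfolding quad_form_row sum_f by (simp add: less_eq_complex_def)
  qed
qed

section \<open>The reproducing kernel Hilbert space on a finite set\<close>

text \<open>The space on \<open>S\<close> is the span of the family \<open>e\<close>, with \<open>e\<close> as an orthonormal basis. Its
  kernel is \<open>\<Sum>\<^sub>l e\<^sub>l(x) cnj (e\<^sub>l(y))\<close>.\<close>

locale biorthogonal_family =
  fixes S :: "'a set" and t :: nat and e d :: "nat \<Rightarrow> 'a \<Rightarrow> complex"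
  assumes finite_S: "finite S"
    and dual: "\<And>l m. l < t \<Longrightarrow> m < t \<Longrightarrow> (\<Sum>x\<in>S. d l x * e m x) = (if l = m then 1 else 0)"
begin

definition coord :: "nat \<Rightarrow> ('a \<Rightarrow> complex) \<Rightarrow> complex" where
  "coord l f = (\<Sum>x\<in>S. d l x * f x)"

definition synth :: "(nat \<Rightarrow> complex) \<Rightarrow> 'a \<Rightarrow> complex" where
  "synth a = (\<lambda>x. if x \<in> S then \<Sum>l<t. a l * e l x else 0)"

definition fspace :: "('a \<Rightarrow> complex) set" where
  "fspace = range synth"

definition fip :: "('a \<Rightarrow> complex) \<Rightarrow> ('a \<Rightarrow> complex) \<Rightarrow> complex" where
  "fip f g = (\<Sum>l<t. coord l f * cnj (coord l g))"

lemma coord_synth: "l < t \<Longrightarrow> coord l (synth a) = a l"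
proof -
  assume l: "l < t"
  have "coord l (synth a) = (\<Sum>x\<in>S. \<Sum>m<t. a m * (d l x * e m x))"
    unfolding coord_def synth_def by (intro sum.cong refl) (simp add: sum_distrib_left algebra_simps)
  also have "\<dots> = (\<Sum>m<t. a m * (\<Sum>x\<in>S. d l x * e m x))"
    by (subst sum.swap) (simp add: sum_distrib_left)
  also have "\<dots> = (\<Sum>m<t. if l = m then a m else 0)"
    using dual[OF l] by (intro sum.cong refl) auto
  finally show ?thesis
    using l by simp
qed

lemma synth_cong: "(\<And>l. l < t \<Longrightarrow> a l = b l) \<Longrightarrow> synth a = synth b"
  unfolding synth_def by (intro ext if_cong sum.cong refl) auto

lemma synth_coord: "f \<in> fspace \<Longrightarrow> synth (\<lambda>l. coord l f) = f"
  unfolding fspace_def by (auto simp: coord_synth intro!: synth_cong)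

lemma coord_add: "coord l (\<lambda>x. f x + g x) = coord l f + coord l g"
  by (simp add: coord_def sum.distrib algebra_simps)

lemma coord_diff: "coord l (\<lambda>x. f x - g x) = coord l f - coord l g"
  by (simp add: coord_def sum_subtractf algebra_simps)

lemma coord_scale: "coord l (\<lambda>x. c * f x) = c * coord l f"
  by (simp add: coord_def sum_distrib_left algebra_simps)

lemma synth_add: "synth (\<lambda>l. a l + b l) = (\<lambda>x. synth a x + synth b x)"
  by (auto simp: synth_def sum.distrib algebra_simps)

lemma synth_scale: "synth (\<lambda>l. c * a l) = (\<lambda>x. c * synth a x)"
  by (auto simp: synth_def sum_distrib_left algebra_simps)

lemma fip_self: "fip f f = complex_of_real (\<Sum>l<t. (cmod (coord l f))\<^sup>2)"
  unfolding fip_def of_real_sum complex_norm_square ..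

lemma ip_norm_fip: "ip_norm fip f = sqrt (\<Sum>l<t. (cmod (coord l f))\<^sup>2)"
  by (simp only: ip_norm_def fip_self Re_complex_of_real)

lemma coord_le_ip_norm: "l < t \<Longrightarrow> cmod (coord l f) \<le> ip_norm fip f"
  unfolding ip_norm_fip by (rule real_le_rsqrt) (rule member_le_sum, auto)

lemma fspace_complete:
  assumes u: "\<And>n :: nat. u n \<in> fspace"
    and cauchy: "\<And>\<epsilon>. \<epsilon> > 0 \<Longrightarrow> \<exists>N. \<forall>m\<ge>N. \<forall>n\<ge>N. ip_norm fip (\<lambda>x. u m x - u n x) < \<epsilon>"
  shows "\<exists>f\<in>fspace. (\<lambda>n. ip_norm fip (\<lambda>x. u n x - f x)) \<longlonglongrightarrow> 0"
proof -
  have "\<exists>a. (\<lambda>n. coord l (u n)) \<longlonglongrightarrow> a" if l: "l < t" for l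
  proof -
    have "Cauchy (\<lambda>n. coord l (u n))"
    proof (rule CauchyI)
      fix \<epsilon> :: real assume "\<epsilon> > 0"
      then obtain N where "\<forall>m\<ge>N. \<forall>n\<ge>N. ip_norm fip (\<lambda>x. u m x - u n x) < \<epsilon>"
        using cauchy by blast
      moreover have "cmod (coord l (u m) - coord l (u n)) \<le> ip_norm fip (\<lambda>x. u m x - u n x)" for m n
        using coord_le_ip_norm[OF l, of "\<lambda>x. u m x - u n x"] by (simp add: coord_diff)
      ultimately show "\<exists>N. \<forall>m\<ge>N. \<forall>n\<ge>N. norm (coord l (u m) - coord l (u n)) < \<epsilon>"
        by (meson le_less_trans)
    qed
    then show ?thesis
      using Cauchy_convergent convergent_def by blast
  qed
  then obtain a where a: "\<And>l. l < t \<Longrightarrow> (\<lambda>n. coord l (u n)) \<longlonglongrightarrow> a l"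
    by metis
  have "(\<lambda>n. ip_norm fip (\<lambda>x. u n x - synth a x))
      = (\<lambda>n. sqrt (\<Sum>l<t. (cmod (coord l (u n) - a l))\<^sup>2))"
    unfolding ip_norm_fip by (intro ext arg_cong[where f = sqrt] sum.cong refl) (simp add: coord_diff coord_synth)
  also have "\<dots> \<longlonglongrightarrow> sqrt (\<Sum>l<t. (cmod (a l - a l))\<^sup>2)"
    by (intro tendsto_intros a) auto
  finally show ?thesis
    by (intro bexI[of _ "synth a"]) (auto simp: fspace_def)
qed

lemma rkhs_fspace:
  assumes K: "\<And>x y. x \<in> S \<Longrightarrow> y \<in> S \<Longrightarrow> K x y = (\<Sum>l<t. e l x * cnj (e l y))"
  shows "rkhs S K fspace fip"
proof
  have kernel: "kernel_fun S K y = synth (\<lambda>l. cnj (e l y))" if "y \<in> S" for y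
    using that K by (auto simp: kernel_fun_def synth_def mult.commute intro!: ext)
  then show "kernel_fun S K y \<in> fspace" if "y \<in> S" for y
    using that by (simp add: fspace_def)
  show "f y = fip f (kernel_fun S K y)" if "f \<in> fspace" "y \<in> S" for f y
  proof -
    have "f y = synth (\<lambda>l. coord l f) y"
      using synth_coord[OF that(1)] by simp
    moreover have "coord l (kernel_fun S K y) = cnj (e l y)" if "l < t" for l
      using kernel[OF \<open>y \<in> S\<close>] coord_synth[OF that] by simp
    ultimately show ?thesis
      using that(2) by (simp add: synth_def fip_def)
  qed
  show "f x = 0" if "f \<in> fspace" "x \<notin> S" for f x
    using that by (auto simp: fspace_def synth_def)
  show "(\<lambda>x. 0) \<in> fspace"
    unfolding fspace_def by (rule range_eqI[of _ _ "\<lambda>l. 0"]) (auto simp: synth_def)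
  show "(\<lambda>x. f x + g x) \<in> fspace" if "f \<in> fspace" "g \<in> fspace" for f g
    using that unfolding fspace_def by (auto simp flip: synth_add)
  show "(\<lambda>x. c * f x) \<in> fspace" if "f \<in> fspace" for c f
    using that unfolding fspace_def by (auto simp flip: synth_scale)
  show "fip (\<lambda>x. f x + g x) h = fip f h + fip g h" for f g h
    by (simp add: fip_def coord_add sum.distrib algebra_simps)
  show "fip (\<lambda>x. c * f x) h = c * fip f h" for c f h
    by (simp add: fip_def coord_scale sum_distrib_left algebra_simps)
  show "fip g f = cnj (fip f g)" for f g
    by (simp add: fip_def mult.commute)
  show "0 \<le> fip f f" for f
    by (simp add: fip_self less_eq_complex_def sum_nonneg del: of_real_sum)
  show "f = (\<lambda>x. 0)" if "f \<in> fspace" "fip f f = 0" for f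
  proof -
    have "(\<Sum>l<t. (cmod (coord l f))\<^sup>2) = 0"
      using that(2) unfolding fip_self of_real_eq_0_iff .
    then have "coord l f = 0" if "l < t" for l
      using that by (simp add: sum_nonneg_eq_0_iff)
    then show ?thesis
      by (subst synth_coord[OF that(1), symmetric]) (simp add: synth_def cong: if_cong)
  qed
qed (use fspace_complete in blast)

text \<open>A functional dominated by the norm is evaluated by a vector in the space. The assumption
  bounds every linear combination of values of \<open>h\<close> by the form of the kernel at the same
  coefficients. Coefficients \<open>c\<close> at which the form vanishes therefore annihilate \<open>h\<close>; taking for \<open>c\<close>
  the defect of the coordinate expansion at a point shows that \<open>h\<close> equals its expansion. Taking for
  \<open>c\<close> the functional whose coordinates are the conjugates of those of \<open>h\<close> gives the norm bound.\<close>

lemma fspace_memI: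
  assumes outside: "\<And>x. x \<notin> S \<Longrightarrow> h x = 0"
    and bound: "\<And>c. (cmod (\<Sum>x\<in>S. c x * h x))\<^sup>2 \<le> C * (\<Sum>l<t. (cmod (\<Sum>x\<in>S. c x * e l x))\<^sup>2)"
  shows "h \<in> fspace" and "C \<ge> 0 \<Longrightarrow> Re (fip h h) \<le> C"
proof -
  have delta: "(\<Sum>x\<in>S. (if x = y then 1 else 0) * g x) = g y" if "y \<in> S" for y and g :: "'a \<Rightarrow> complex"
    using that finite_S by (simp add: if_distrib[of "\<lambda>u. u * _"] cong: if_cong)
  have "h y = synth (\<lambda>l. coord l h) y" for y
  proof (cases "y \<in> S")
    case y: True
    define c where "c x = (if x = y then 1 else 0) - (\<Sum>l<t. e l y * d l x)" for x
    have c: "(\<Sum>x\<in>S. c x * g x) = g y - (\<Sum>l<t. e l y * coord l g)" for g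
    proof -
      have "(\<Sum>x\<in>S. (\<Sum>l<t. e l y * d l x) * g x) = (\<Sum>l<t. e l y * coord l g)"
        unfolding coord_def sum_distrib_left sum_distrib_right by (subst sum.swap) (simp add: mult.assoc)
      then show ?thesis
        using delta[OF y, of g] by (simp add: c_def left_diff_distrib sum_subtractf)
    qed
    have "(\<Sum>x\<in>S. c x * e m x) = 0" if m: "m < t" for m
    proof -
      have "(\<Sum>l<t. e l y * coord l (e m)) = (\<Sum>l<t. if l = m then e l y else 0)"
        unfolding coord_def using dual m by (intro sum.cong refl) auto
      then show ?thesis
        using m by (simp add: c)
    qed
    then have "(\<Sum>x\<in>S. c x * h x) = 0"
      using bound[of c] by simp
    then show ?thesis
      using y by (simp add: c synth_def mult.commute)
  qed (simp add: outside synth_def)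
  then have "h = synth (\<lambda>l. coord l h)"
    by blast
  then show "h \<in> fspace"
    unfolding fspace_def by blast
next
  assume "C \<ge> 0"
  define A where "A = (\<Sum>l<t. (cmod (coord l h))\<^sup>2)"
  define c where "c x = (\<Sum>l<t. cnj (coord l h) * d l x)" for x
  have c: "(\<Sum>x\<in>S. c x * g x) = (\<Sum>l<t. cnj (coord l h) * coord l g)" for g
    unfolding coord_def[of _ g] c_def sum_distrib_left sum_distrib_right
    by (subst sum.swap) (simp add: mult.assoc)
  have "(\<Sum>x\<in>S. c x * h x) = complex_of_real A"
    unfolding c A_def of_real_sum complex_norm_square by (simp add: mult.commute)
  moreover
  have "(\<Sum>x\<in>S. c x * e m x) = cnj (coord m h)" if m: "m < t" for m
  proof -
    have "(\<Sum>l<t. cnj (coord l h) * coord l (e m)) = (\<Sum>l<t. if l = m then cnj (coord l h) else 0)"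
      unfolding coord_def[of _ "e m"] using dual m by (intro sum.cong refl) auto
    then show ?thesis
      using m by (simp add: c)
  qed
  then have "(\<Sum>m<t. (cmod (\<Sum>x\<in>S. c x * e m x))\<^sup>2) = A"
    by (simp add: A_def)
  ultimately have "A * A \<le> A * C"
    using bound[of c] by (simp add: power2_eq_square mult.commute)
  then have "A \<le> C"
    using \<open>C \<ge> 0\<close> by (cases "A > 0") auto
  then show "Re (fip h h) \<le> C"
    unfolding fip_self A_def by simp
qed

text \<open>Positivity says that the adjoint of multiplication by \<open>w\<close> is contractive on combinations of
  kernel functions. By duality the product \<open>h\<close> satisfies the bound in \<open>fspace_memI\<close>: expanding the
  \<open>f\<^sub>l\<close> in the basis, a combination of values of \<open>h\<close> is a pairing of the coordinates \<open>\<alpha>\<close> of the tuple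
  with the coordinates \<open>\<beta>\<close> of the conjugate of the image under the adjoint.\<close>

lemma contractive_row_fspace:
  assumes K: "\<And>x y. x \<in> S \<Longrightarrow> y \<in> S \<Longrightarrow> K x y = (\<Sum>l<t. e l x * cnj (e l y))"
    and psd: "psd_on S (\<lambda>x y. (1 - (\<Sum>l<n. w l x * cnj (w l y))) * K x y)"
  shows "contractive_row S fspace fip n w"
  unfolding contractive_row_def
proof (intro allI impI)
  fix f assume f: "\<forall>l<n. f l \<in> fspace"
  let ?h = "row_mult S n w f"
  let ?I = "{..<n} \<times> {..<t}"
  define C where "C = (\<Sum>l<n. Re (fip (f l) (f l)))"
  define \<alpha> where "\<alpha> = (\<lambda>(l, m). coord m (f l))"
  have C_eq: "C = (\<Sum>i\<in>?I. (cmod (\<alpha> i))\<^sup>2)"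
    unfolding C_def fip_self by (simp add: \<alpha>_def sum.cartesian_product case_prod_unfold)
  have "(cmod (\<Sum>x\<in>S. c x * ?h x))\<^sup>2 \<le> C * (\<Sum>l<t. (cmod (\<Sum>x\<in>S. c x * e l x))\<^sup>2)" for c
  proof -
    define \<beta> where "\<beta> = (\<lambda>(l, m). \<Sum>x\<in>S. c x * w l x * e m x)"
    have f_eq: "f l x = (\<Sum>m<t. coord m (f l) * e m x)" if "l < n" "x \<in> S" for l x
    proof -
      have "f l x = synth (\<lambda>m. coord m (f l)) x"
        using synth_coord[of "f l"] f that(1) by (simp only:)
      also have "\<dots> = (\<Sum>m<t. coord m (f l) * e m x)"
        unfolding synth_def using that(2) by (simp only: if_True)
      finally show ?thesis .
    qed
    have "(\<Sum>x\<in>S. c x * ?h x) = (\<Sum>x\<in>S. \<Sum>l<n. \<Sum>m<t. coord m (f l) * (c x * w l x * e m x))"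
      unfolding row_mult_def by (intro sum.cong refl) (simp add: f_eq sum_distrib_left algebra_simps)
    also have "\<dots> = (\<Sum>l<n. \<Sum>x\<in>S. \<Sum>m<t. coord m (f l) * (c x * w l x * e m x))"
      by (rule sum.swap)
    also have "\<dots> = (\<Sum>l<n. \<Sum>m<t. \<Sum>x\<in>S. coord m (f l) * (c x * w l x * e m x))"
      by (intro sum.cong refl sum.swap)
    also have "\<dots> = (\<Sum>l<n. \<Sum>m<t. \<alpha> (l, m) * \<beta> (l, m))"
      by (simp add: \<alpha>_def \<beta>_def sum_distrib_left)
    also have "\<dots> = (\<Sum>i\<in>?I. \<alpha> i * \<beta> i)"
      by (simp add: sum.cartesian_product case_prod_unfold)
    finally have "cmod (\<Sum>x\<in>S. c x * ?h x) \<le> (\<Sum>i\<in>?I. \<bar>cmod (\<alpha> i)\<bar> * \<bar>cmod (\<beta> i)\<bar>)"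
      using norm_sum[of "\<lambda>i. \<alpha> i * \<beta> i" ?I] by (simp add: norm_mult)
    also have "\<dots> \<le> L2_set (\<lambda>i. cmod (\<alpha> i)) ?I * L2_set (\<lambda>i. cmod (\<beta> i)) ?I"
      by (rule L2_set_mult_ineq)
    finally have "(cmod (\<Sum>x\<in>S. c x * ?h x))\<^sup>2
        \<le> (L2_set (\<lambda>i. cmod (\<alpha> i)) ?I * L2_set (\<lambda>i. cmod (\<beta> i)) ?I)\<^sup>2"
      by (rule power_mono) simp
    also have "\<dots> = C * (\<Sum>i\<in>?I. (cmod (\<beta> i))\<^sup>2)"
      by (simp add: power_mult_distrib C_eq L2_set_def sum_nonneg)
    also have "(\<Sum>i\<in>?I. (cmod (\<beta> i))\<^sup>2) \<le> (\<Sum>m<t. (cmod (\<Sum>x\<in>S. c x * e m x))\<^sup>2)"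
    proof -
      have squares: "quad_form S K b = complex_of_real (\<Sum>m<t. (cmod (\<Sum>x\<in>S. cnj (b x) * e m x))\<^sup>2)" for b
        by (rule quad_form_factored) (rule K)
      have "quad_form S K (\<lambda>x. cnj (w l x) * cnj (c x)) = complex_of_real (\<Sum>m<t. (cmod (\<beta> (l, m)))\<^sup>2)" for l
        unfolding squares by (simp add: \<beta>_def mult.commute)
      moreover have "quad_form S K (\<lambda>x. cnj (c x)) = complex_of_real (\<Sum>m<t. (cmod (\<Sum>x\<in>S. c x * e m x))\<^sup>2)"
        unfolding squares by simp
      ultimately have "0 \<le> complex_of_real (\<Sum>m<t. (cmod (\<Sum>x\<in>S. c x * e m x))\<^sup>2)
          - (\<Sum>l<n. complex_of_real (\<Sum>m<t. (cmod (\<beta> (l, m)))\<^sup>2))"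
        using psd_on_quad_form[OF psd, of "\<lambda>x. cnj (c x)"] unfolding quad_form_row by simp
      then have "(\<Sum>l<n. \<Sum>m<t. (cmod (\<beta> (l, m)))\<^sup>2) \<le> (\<Sum>m<t. (cmod (\<Sum>x\<in>S. c x * e m x))\<^sup>2)"
        unfolding of_real_sum[symmetric] of_real_diff[symmetric] by (simp add: less_eq_complex_def del: of_real_sum of_real_diff)
      then show ?thesis
        by (simp add: sum.cartesian_product)
    qed
    finally show ?thesis
      by (simp add: C_eq sum_nonneg mult_left_mono)
  qed
  note * = this
  have "?h x = 0" if "x \<notin> S" for x
    using that by (simp add: row_mult_def)
  then show "?h \<in> fspace \<and> Re (fip ?h ?h) \<le> (\<Sum>l<n. Re (fip (f l) (f l)))"
    using fspace_memI[of ?h C, OF _ *] unfolding C_def[symmetric] by (simp add: C_eq sum_nonneg)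
qed

end

lemma psd_on_imp_row_mult1:
  assumes "finite S" "psd_on S K"
    and "psd_on S (\<lambda>x y. (1 - (\<Sum>l<n. w l x * cnj (w l y))) * K x y)"
  shows "(\<lambda>x. mat 1 n (\<lambda>(i, l). w l x)) \<in> mult1 S K n 1"
proof -
  obtain t and e d :: "nat \<Rightarrow> 'a \<Rightarrow> complex"
    where K: "\<And>x y. x \<in> S \<Longrightarrow> y \<in> S \<Longrightarrow> K x y = (\<Sum>l<t. e l x * cnj (e l y))"
      and dual: "\<And>l m. l < t \<Longrightarrow> m < t \<Longrightarrow> (\<Sum>x\<in>S. d l x * e m x) = (if l = m then 1 else 0)"
    using psd_on_factorization[OF assms(1,2)] by blast
  interpret biorthogonal_family S t e d
    using assms(1) dual by unfold_locales
  have "contractive_row S fspace fip n w"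
    by (rule contractive_row_fspace[OF K assms(3)])
  moreover have "contractive_row S fspace fip n w
      = contractive_row S fspace fip n (\<lambda>l x. mat 1 n (\<lambda>(i, l). w l x) $$ (0, l))"
    unfolding contractive_row_def row_mult_def by (simp cong: if_cong)
  ultimately show ?thesis
    using rkhs_fspace[OF K] by (subst mult1_row_iff) auto
qed

section \<open>The complete Pick property\<close>

theorem mainTheorem1:
  fixes X :: "'a set" and k :: "'a \<Rightarrow> 'a \<Rightarrow> complex"
  assumes "psd_kernel X k"
    and "\<And>x y. x \<in> X \<Longrightarrow> y \<in> X \<Longrightarrow> k x y \<noteq> 0"
    and "complete_pick X k"
  shows "\<forall>z\<in>X. psd_kernel X (\<lambda>x y. 1 - (k x z * k z y) / (k z z * k x y))"
proof -
  let ?F = "\<lambda>z x y. 1 - (k x z * k z y) / (k z z * k x y)"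
  have psd: "psd_on S k" if "finite S" "S \<subseteq> X" for S
    using assms(1) that by (simp add: psd_kernel_iff_psd_on)
  have herm: "k y x = cnj (k x y)" if "x \<in> X" "y \<in> X" for x y
    using psd_on_hermitian[OF psd[of "{x, y}"], of x y] that by simp
  have "\<forall>z\<in>X. psd_on S (?F z)" if "finite S" "S \<subseteq> X" for S
    using that
  proof (induction S rule: finite_induct)
    case empty
    show ?case by (simp add: psd_on_def quad_form_def)
  next
    case (insert w S)
    let ?S = "insert w S"
    have S: "finite ?S" "?S \<subseteq> X" and w: "w \<in> X"
      using insert by auto
    have "psd_on S (?F w)"
      using insert by simp
    then have F_w: "psd_on ?S (?F w)"
      using insert.hyps S w assms(2) by (intro psd_on_insert_zero) auto
    obtain n and e :: "nat \<Rightarrow> 'a \<Rightarrow> complex"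
      where e: "\<And>x y. x \<in> ?S \<Longrightarrow> y \<in> ?S \<Longrightarrow> ?F w x y = (\<Sum>l<n. e l x * cnj (e l y))"
      using psd_on_factorization[OF S(1) F_w] by blast
    \<comment> \<open>\<open>(1 - F\<^sub>w(x,y)) k(x,y) = g(x) cnj (g(y))\<close>.\<close>
    define g where "g x = k x w / complex_of_real (sqrt (Re (k w w)))" for x
    have g: "g x * cnj (g y) = k x w * k w y / k w w" if "x \<in> X" "y \<in> X" for x y
    proof -
      have "0 \<le> k w w"
        using psd_on_diag[OF psd[of "{w}"]] w by simp
      then have "complex_of_real (sqrt (Re (k w w))) * complex_of_real (sqrt (Re (k w w))) = k w w"
        by (auto simp: less_eq_complex_def complex_eq_iff simp flip: of_real_mult)
      then show ?thesis
        using herm[OF that(2) w] by (simp add: g_def)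
    qed
    have defect: "1 - (\<Sum>l<n. e l x * cnj (e l y)) = g x * cnj (g y) / k x y" if "x \<in> ?S" "y \<in> ?S" for x y
    proof -
      have "x \<in> X" "y \<in> X"
        using that S by auto
      then show ?thesis
        by (simp add: g flip: e[OF that])
    qed
    have "psd_on ?S (\<lambda>x y. (1 - (\<Sum>l<n. e l x * cnj (e l y))) * k x y)
        = psd_on ?S (\<lambda>x y. g x * cnj (g y))"
    proof (rule psd_on_cong)
      show "(1 - (\<Sum>l<n. e l x * cnj (e l y))) * k x y = g x * cnj (g y)" if "x \<in> ?S" "y \<in> ?S" for x y
        using defect[OF that] assms(2)[of x y] that S by auto
    qed
    then have W: "(\<lambda>x. mat 1 n (\<lambda>(i, l). e l x)) \<in> mult1 ?S k n 1"
      using psd_on_rank_one S psd by (intro psd_on_imp_row_mult1) auto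
    obtain \<Phi> where \<Phi>: "\<Phi> \<in> mult1 X k n 1" "\<And>x. x \<in> ?S \<Longrightarrow> \<Phi> x = mat 1 n (\<lambda>(i, l). e l x)"
      using assms(3)[unfolded complete_pick_def, rule_format, OF S(2,1) W] by auto
    have "\<And>x. x \<in> X \<Longrightarrow> \<Phi> x \<in> carrier_mat 1 n"
      using \<Phi>(1) by (simp add: mult1_def)
    then obtain H ip where rkhs: "rkhs X k H ip"
      and row: "contractive_row X H ip n (\<lambda>l x. \<Phi> x $$ (0, l))"
      using \<Phi>(1) mult1_row_iff by blast
    show ?case
    proof
      fix z assume z: "z \<in> X"
      have "psd_on ?S (\<lambda>x y. (1 - (\<Sum>l<n. \<Phi> x $$ (0, l) * cnj (\<Phi> y $$ (0, l))))
          * (k x y - k x z * k z y / k z z))"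
        by (rule rkhs.contractive_row_imp_psd_on[OF rkhs row z assms(2)[OF z z] S])
      also have "?this \<longleftrightarrow> psd_on ?S (\<lambda>x y. g x * cnj (g y) * ?F z x y)"
      proof (rule psd_on_cong)
        fix x y assume xy: "x \<in> ?S" "y \<in> ?S"
        then have nz: "k x y \<noteq> 0" "k z z \<noteq> 0"
          using S z assms(2) by auto
        have "(\<Sum>l<n. \<Phi> x $$ (0, l) * cnj (\<Phi> y $$ (0, l))) = (\<Sum>l<n. e l x * cnj (e l y))"
          using \<Phi>(2) xy by simp
        then have defect_\<Phi>: "(1 - (\<Sum>l<n. \<Phi> x $$ (0, l) * cnj (\<Phi> y $$ (0, l)))) = g x * cnj (g y) / k x y"
          using defect[OF xy] by simp
        show "(1 - (\<Sum>l<n. \<Phi> x $$ (0, l) * cnj (\<Phi> y $$ (0, l)))) * (k x y - k x z * k z y / k z z)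
            = g x * cnj (g y) * ?F z x y"
          unfolding defect_\<Phi> using nz by (simp add: field_simps)
      qed
      finally show "psd_on ?S (?F z)"
      proof (rule psd_on_rescale)
        fix x assume "x \<in> ?S"
        then show "g x \<noteq> 0"
          using g[of x x] assms(2)[of x w] assms(2)[of w x] assms(2)[of w w] w S by auto
      qed
    qed
  qed
  then show ?thesis
    by (simp add: psd_kernel_iff_psd_on)
qed

end
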